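(* Let $T$ be the $d$-adic tree and let $G\le\operatorname{Aut}T$ be level transitive and super strongly fractal. Let $S\subseteq G$ and $K=\langle S\rangle^G$. If $K\subseteq\operatorname{st}_G(L_n)$ for some $n\in\mathbb{N}$, then $\psi_u(K)=\langle\psi_v(S)\mid v\in L_n\rangle^G$ for any $u\in L_n$.
   Context: The vertices of the $d$-adic tree $T$ are the words in the free monoid $X^*$, $|X|=d$; the root is the empty word, and $u$ is joined to $ux$ for $x\in X$. $L_n$ is the set of words of length $n$. $\operatorname{Aut}T$ is the group of automorphisms of the rooted tree $T$, with product $(fg)(u)=g(f(u))$. For $g\in\operatorname{Aut}T$ and a vertex $u$, the section $g_u\in\operatorname{Aut}T$ is defined by $g(uv)=g(u)g_u(v)$ for all $v\in X^*$. $\operatorname{st}_G(L_n)$ is the subgroup of elements of $G$ fixing every vertex of $L_n$, and $\psi_u$ is the homomorphism $g\mapsto g_u$ defined on the stabilizer of $u$. $G$ is level transitive if it acts transitively on $L_n$ for every $n$. $G$ is self-similar if $g_u\in G$ for all $g\in G$ and all vertices $u$; a self-similar group $G$ is super strongly fractal if $\psi_u(\operatorname{st}_G(L_n))=G$ for every $n\in\mathbb{N}$ and every $u\in L_n$. $\langle S\rangle^G$ denotes the normal closure of $S$ in $G$; $\langle\psi_v(S)\mid v\in L_n\rangle^G$ is the normal closure in $G$ of $\bigcup_{v\in L_n}\psi_v(S)$. *)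

theory Defs
  imports "HOL-Algebra.Coset" "HOL.Hull"
begin

text \<open>
  The alphabet is a finite type \<^typ>\<open>'x\<close>, with \<open>d = CARD('x)\<close>, and the vertices of the
  \<open>d\<close>-adic tree are the lists over it; \<^term>\<open>[]\<close> is the root.
\<close>

definition level :: "nat \<Rightarrow> 'x list set" where
  "level n = {u. length u = n}"

definition adjacent :: "'x list \<Rightarrow> 'x list \<Rightarrow> bool" where
  "adjacent u v \<longleftrightarrow> (\<exists>x. v = u @ [x]) \<or> (\<exists>x. u = v @ [x])"

definition tree_automorphism :: "('x list \<Rightarrow> 'x list) \<Rightarrow> bool" where
  "tree_automorphism f \<longleftrightarrow>
     bij f \<and> f [] = [] \<and> (\<forall>u v. adjacent (f u) (f v) \<longleftrightarrow> adjacent u v)"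

text \<open>Automorphisms act from the left but are multiplied from left to right: \<open>(fg)(u) = g(f(u))\<close>.\<close>

definition AutT :: "('x list \<Rightarrow> 'x list) monoid" where
  "AutT = \<lparr>carrier = {f. tree_automorphism f}, mult = (\<lambda>f g. g \<circ> f), one = id\<rparr>"

definition section_at :: "('x list \<Rightarrow> 'x list) \<Rightarrow> 'x list \<Rightarrow> ('x list \<Rightarrow> 'x list)" where
  "section_at g u = (THE h. \<forall>v. g (u @ v) = g u @ h v)"

definition psi :: "'x list \<Rightarrow> ('x list \<Rightarrow> 'x list) \<Rightarrow> ('x list \<Rightarrow> 'x list)" where
  "psi u = (\<lambda>g \<in> {g \<in> carrier AutT. g u = u}. section_at g u)"

definition level_stabilizer :: "('x list \<Rightarrow> 'x list) set \<Rightarrow> nat \<Rightarrow> ('x list \<Rightarrow> 'x list) set" where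
  "level_stabilizer G n = {g \<in> G. \<forall>u \<in> level n. g u = u}"

definition level_transitive :: "('x list \<Rightarrow> 'x list) set \<Rightarrow> bool" where
  "level_transitive G \<longleftrightarrow> (\<forall>n. \<forall>u \<in> level n. \<forall>v \<in> level n. \<exists>g \<in> G. g u = v)"

definition self_similar :: "('x list \<Rightarrow> 'x list) set \<Rightarrow> bool" where
  "self_similar G \<longleftrightarrow> (\<forall>g \<in> G. \<forall>u. section_at g u \<in> G)"

definition super_strongly_fractal :: "('x list \<Rightarrow> 'x list) set \<Rightarrow> bool" where
  "super_strongly_fractal G \<longleftrightarrow>
     self_similar G \<and> (\<forall>n. \<forall>u \<in> level n. psi u ` level_stabilizer G n = G)"

text \<open>
  The smallest normal subgroup of \<^term>\<open>G\<close> containing \<^term>\<open>S\<close>. This is meaningful only for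
  \<open>S \<subseteq> carrier G\<close>; otherwise the intersection is over the empty family.
\<close>

definition normal_closure :: "('a, 'b) monoid_scheme \<Rightarrow> 'a set \<Rightarrow> 'a set" where
  "normal_closure G S = (\<lambda>N. N \<lhd> G) hull S"

lemma tree_automorphism_snoc:
  assumes g: "tree_automorphism g"
  shows "\<exists>y. g (u @ [x]) = g u @ [y]"
proof (induction u arbitrary: x rule: rev_induct)
  case Nil
  have "adjacent (g []) (g [x]) = adjacent [] [x]" using g unfolding tree_automorphism_def by blast
  then show ?case using g by (auto simp: tree_automorphism_def adjacent_def)
next
  case (snoc a u)
  from snoc obtain b where b: "g (u @ [a]) = g u @ [b]" by blast
  have adj: "adjacent (g (u @ [a])) (g ((u @ [a]) @ [x]))"
    using g unfolding tree_automorphism_def adjacent_def by blast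
  show ?case
  proof (rule ccontr)
    assume "\<not> ?case"
    with adj obtain c where "g (u @ [a]) = g ((u @ [a]) @ [x]) @ [c]"
      by (auto simp: adjacent_def)
    with b have "g ((u @ [a]) @ [x]) = g u" by simp
    moreover have "inj g" using g by (auto simp: tree_automorphism_def bij_def)
    ultimately have "(u @ [a]) @ [x] = u" by (rule injD[rotated])
    then show False by simp
  qed
qed

lemma section_at_eq:
  assumes g: "tree_automorphism g"
  shows "g (u @ v) = g u @ section_at g u v"
proof -
  have "\<exists>w. g (u @ v) = g u @ w" for v
  proof (induction v rule: rev_induct)
    case (snoc x v)
    then show ?case using tree_automorphism_snoc[OF g, of "u @ v" x] by auto
  qed simp
  then obtain h where h: "\<forall>v. g (u @ v) = g u @ h v" by metis
  have "\<forall>v. g (u @ v) = g u @ section_at g u v"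
    unfolding section_at_def
  proof (rule theI[where P = "\<lambda>h. \<forall>v. g (u @ v) = g u @ h v"])
    show "\<forall>v. g (u @ v) = g u @ h v" by (fact h)
    show "k = h" if "\<forall>v. g (u @ v) = g u @ k v" for k
      using that h by (intro ext) (metis same_append_eq)
  qed
  then show ?thesis by blast
qed

lemma group_AutT: "group AutT"
proof (rule groupI)
  fix f :: "'x list \<Rightarrow> 'x list" assume "f \<in> carrier AutT"
  then have f: "tree_automorphism f" by (simp add: AutT_def)
  let ?i = "inv_into UNIV f"
  from f have bij: "bij f" by (simp add: tree_automorphism_def)
  then have r: "f (?i u) = u" for u by (simp add: bij_is_surj surj_f_inv_f)
  have "tree_automorphism (?i)"
    unfolding tree_automorphism_def
  proof (intro conjI allI)
    show "bij (?i)" using bij by (rule bij_imp_bij_inv)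
    show "?i [] = []" using f bij by (metis tree_automorphism_def bij_inv_eq_iff)
    show "adjacent (?i u) (?i v) = adjacent u v" for u v
      using f r unfolding tree_automorphism_def by metis
  qed
  moreover have "f \<circ> ?i = id" using r by (auto simp: fun_eq_iff)
  ultimately show "\<exists>g \<in> carrier AutT. g \<otimes>\<^bsub>AutT\<^esub> f = \<one>\<^bsub>AutT\<^esub>"
    by (auto simp: AutT_def)
qed (auto simp: AutT_def tree_automorphism_def bij_comp comp_assoc)

end

theory Submission
  imports Defs
begin

text \<open>
  Everything rests on how sections interact with conjugation. If \<open>k\<close> fixes the vertex \<open>g(v)\<close>,
  then \<open>g k g\<^sup>-\<^sup>1\<close> fixes \<open>v\<close>, and its section at \<open>v\<close> is the conjugate of \<open>k\<^bsub>g(v)\<^esub>\<close> by \<open>g\<^bsub>v\<^esub>\<close>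
  (\<open>section_at_conj\<close>). Write \<open>N\<close> for the normal closure of the sections of \<open>S\<close> on level \<open>n\<close>.

  By self-similarity the conjugator \<open>g\<^bsub>v\<^esub>\<close> lies in \<open>G\<close>, so normality of \<open>N\<close> makes the set of all
  elements of \<open>st\<^bsub>G\<^esub>(L\<^sub>n)\<close> whose sections on level \<open>n\<close> all lie in \<open>N\<close> a normal subgroup of \<open>G\<close>. All
  vertices of the level have to be considered at once here, because conjugation permutes them
  (\<open>normal_level_sections\<close>).
  This subgroup contains \<open>S\<close>, hence \<open>K\<close>, so \<open>\<psi>\<^bsub>u\<^esub>(K) \<subseteq> N\<close>.

  For the converse, \<open>\<psi>\<^bsub>u\<^esub>\<close> is a homomorphism from \<open>st\<^bsub>G\<^esub>(L\<^sub>n)\<close> onto \<open>G\<close> by super strong fractality, so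
  the image \<open>\<psi>\<^bsub>u\<^esub>(K)\<close> is normal in \<open>G\<close> (\<open>normal_psi_image\<close>). Level transitivity moves the generators
  to \<open>u\<close>: for \<open>s \<in> S\<close> and \<open>v \<in> L\<^sub>n\<close> choose \<open>g \<in> G\<close> with \<open>g(u) = v\<close>; then \<open>\<psi>\<^bsub>u\<^esub>(g s g\<^sup>-\<^sup>1)\<close> is
  conjugate in \<open>G\<close> to \<open>\<psi>\<^bsub>v\<^esub>(s)\<close>, which therefore lies in \<open>\<psi>\<^bsub>u\<^esub>(K)\<close>. So \<open>N \<subseteq> \<psi>\<^bsub>u\<^esub>(K)\<close>.
\<close>

section \<open>Normal subgroups and normal closures\<close>

text \<open>
  This lets inverses in a subgroup \<open>H\<close> be computed in the ambient group.
\<close>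
lemma (in group) normal_in_subgroup_iff:
  assumes H: "subgroup H G"
  shows "N \<lhd> G\<lparr>carrier := H\<rparr> \<longleftrightarrow>
    subgroup N G \<and> N \<subseteq> H \<and> (\<forall>h \<in> H. \<forall>k \<in> N. h \<otimes> k \<otimes> inv h \<in> N)"
proof -
  interpret H: group "G\<lparr>carrier := H\<rparr>" using H by (rule subgroup_imp_group)
  have "N \<subseteq> H" if "subgroup N (G\<lparr>carrier := H\<rparr>)"
    using subgroup.subset[OF that] by simp
  then have "subgroup N (G\<lparr>carrier := H\<rparr>) \<longleftrightarrow> subgroup N G \<and> N \<subseteq> H"
    by (blast intro: incl_subgroup[OF H] subgroup_incl[OF _ H])
  then show ?thesis
    by (simp add: H.normal_inv_iff m_inv_consistent[OF H])
qed

lemma (in group) normal_closure_normal: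
  assumes "S \<subseteq> carrier G"
  shows "normal_closure G S \<lhd> G"
proof -
  have self: "carrier G \<lhd> G"
    by (rule normal_invI[OF subgroup_self]) simp
  have "\<Inter>{N. N \<lhd> G \<and> S \<subseteq> N} \<lhd> G"
  proof (rule normal_invI)
    show "subgroup (\<Inter>{N. N \<lhd> G \<and> S \<subseteq> N}) G"
      using self assms by (intro subgroups_Inter) (auto dest: normal_imp_subgroup)
  qed (auto intro: normal.inv_op_closed2)
  then show ?thesis
    by (simp add: normal_closure_def hull_def)
qed

lemma normal_closure_superset: "S \<subseteq> normal_closure G S"
  unfolding normal_closure_def by (rule hull_subset)

lemma normal_closure_least: "S \<subseteq> N \<Longrightarrow> N \<lhd> G \<Longrightarrow> normal_closure G S \<subseteq> N"
  unfolding normal_closure_def by (rule hull_minimal)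

section \<open>Sections of products, inverses and conjugates\<close>

lemma AutT_simps:
  "g \<in> carrier AutT \<longleftrightarrow> tree_automorphism g"
  "f \<otimes>\<^bsub>AutT\<^esub> g = g \<circ> f"
  "\<one>\<^bsub>AutT\<^esub> = id"
  by (simp_all add: AutT_def)

interpretation AutT: group AutT
  by (rule group_AutT)

lemma AutT_inv_cancel:
  assumes "tree_automorphism g"
  shows "(inv\<^bsub>AutT\<^esub> g) (g v) = v" "g ((inv\<^bsub>AutT\<^esub> g) v) = v"
  using AutT.r_inv[of g] AutT.l_inv[of g] assms
  by (simp_all add: AutT_simps fun_eq_iff)

lemma tree_automorphism_inv:
  "tree_automorphism g \<Longrightarrow> tree_automorphism (inv\<^bsub>AutT\<^esub> g)"
  using AutT.inv_closed[of g] by (simp add: AutT_simps)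

lemma length_tree_automorphism:
  assumes "tree_automorphism g"
  shows "length (g u) = length u"
proof (induction u rule: rev_induct)
  case Nil
  then show ?case using assms by (simp add: tree_automorphism_def)
next
  case (snoc x u)
  then show ?case using tree_automorphism_snoc[OF assms, of u x] by auto
qed

lemma section_at_unique:
  assumes "tree_automorphism g" and "\<And>w. g (v @ w) = g v @ h w"
  shows "section_at g v = h"
proof
  fix w
  have "g v @ section_at g v w = g v @ h w"
    using section_at_eq[OF assms(1), of v w] assms(2)[of w] by simp
  then show "section_at g v w = h w" by simp
qed

lemma section_at_one: "section_at id v = id"
  using AutT.one_closed by (intro section_at_unique) (auto simp: AutT_simps)

lemma section_at_mult:
  assumes "tree_automorphism f" "tree_automorphism g"
  shows "section_at (f \<otimes>\<^bsub>AutT\<^esub> g) v = section_at f v \<otimes>\<^bsub>AutT\<^esub> section_at g (f v)"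
proof (rule section_at_unique)
  show "tree_automorphism (f \<otimes>\<^bsub>AutT\<^esub> g)"
    using AutT.m_closed[of f g] assms by (simp add: AutT_simps(1))
qed (use assms in \<open>simp add: AutT_simps section_at_eq\<close>)

text \<open>
  A section inherits adjacency because a common prefix does not affect it, and it is bijective
  because the section of the inverse at the image vertex undoes it.
\<close>
lemma tree_automorphism_section_at:
  assumes g: "tree_automorphism g"
  shows "tree_automorphism (section_at g v)"
proof -
  let ?h = "section_at g v" and ?i = "section_at (inv\<^bsub>AutT\<^esub> g) (g v)"
  note i = tree_automorphism_inv[OF g]
  have prefix: "adjacent (p @ a) (p @ b) = adjacent a b" for p a b :: "'a list"
    by (simp add: adjacent_def)
  have "v @ ?i (?h w) = v @ w" for w
    using section_at_eq[OF i, of "g v" "?h w"]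
    by (simp add: AutT_inv_cancel[OF g] flip: section_at_eq[OF g])
  moreover have "g v @ ?h (?i w) = g v @ w" for w
  proof -
    have "v @ ?i w = (inv\<^bsub>AutT\<^esub> g) (g v @ w)"
      using section_at_eq[OF i, of "g v" w] by (simp add: AutT_inv_cancel[OF g])
    then show ?thesis
      by (metis section_at_eq[OF g] AutT_inv_cancel(2)[OF g])
  qed
  ultimately have "bij ?h"
    by (intro o_bij[of ?i]) (auto simp: fun_eq_iff)
  moreover have "?h [] = []"
    using section_at_eq[OF g, of v "[]"] by simp
  moreover have "adjacent (?h a) (?h b) = adjacent a b" for a b
  proof -
    have "adjacent (g (v @ a)) (g (v @ b)) = adjacent (v @ a) (v @ b)"
      using g unfolding tree_automorphism_def by blast
    then show ?thesis by (simp add: section_at_eq[OF g] prefix)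
  qed
  ultimately show ?thesis by (simp add: tree_automorphism_def)
qed

lemma section_at_inv:
  assumes g: "tree_automorphism g"
  shows "section_at (inv\<^bsub>AutT\<^esub> g) (g v) = inv\<^bsub>AutT\<^esub> (section_at g v)"
proof -
  have "section_at g v \<otimes>\<^bsub>AutT\<^esub> section_at (inv\<^bsub>AutT\<^esub> g) (g v) = section_at (g \<otimes>\<^bsub>AutT\<^esub> inv\<^bsub>AutT\<^esub> g) v"
    using g tree_automorphism_inv[OF g] by (simp add: section_at_mult)
  also have "\<dots> = \<one>\<^bsub>AutT\<^esub>"
    using g by (simp add: AutT_simps(1) AutT_simps(3) section_at_one)
  finally show ?thesis
    using g tree_automorphism_inv[OF g]
    by (intro AutT.inv_equality[THEN sym] AutT.inv_comm[of "section_at g v"])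
      (simp_all add: AutT_simps(1) tree_automorphism_section_at)
qed

text \<open>
  Products are read from left to right, so \<open>g k g\<^sup>-\<^sup>1\<close> first carries the subtree at \<open>v\<close> to the one
  at \<open>g(v)\<close>, lets \<open>k\<close> act there, and carries it back.
\<close>
lemma section_at_conj:
  assumes g: "tree_automorphism g" and k: "tree_automorphism k" and fixed: "k (g v) = g v"
  shows "section_at (g \<otimes>\<^bsub>AutT\<^esub> k \<otimes>\<^bsub>AutT\<^esub> inv\<^bsub>AutT\<^esub> g) v =
    section_at g v \<otimes>\<^bsub>AutT\<^esub> section_at k (g v) \<otimes>\<^bsub>AutT\<^esub> inv\<^bsub>AutT\<^esub> (section_at g v)"
proof -
  have "tree_automorphism (g \<otimes>\<^bsub>AutT\<^esub> k)"
    using AutT.m_closed[of g k] g k by (simp add: AutT_simps(1))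
  moreover have "(g \<otimes>\<^bsub>AutT\<^esub> k) v = g v"
    using fixed by (simp add: AutT_simps)
  ultimately show ?thesis
    using g k tree_automorphism_inv[OF g] by (simp add: section_at_mult section_at_inv)
qed

section \<open>Level stabilizers and normality\<close>

lemma level_stabilizerD:
  assumes "subgroup G AutT" "k \<in> level_stabilizer G n"
  shows "k \<in> G" "tree_automorphism k" "v \<in> level n \<Longrightarrow> k v = v"
  using assms subgroup.subset[OF assms(1)] by (auto simp: level_stabilizer_def AutT_simps)

lemma psi_level_stabilizer:
  assumes "subgroup G AutT" "k \<in> level_stabilizer G n" "u \<in> level n"
  shows "psi u k = section_at k u"
  using level_stabilizerD[OF assms(1,2)] assms(3) by (simp add: psi_def AutT_simps)

lemma level_stabilizer_subgroup:
  assumes G: "subgroup G AutT"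
  shows "subgroup (level_stabilizer G n) AutT"
proof (rule AutT.subgroupI)
  show "level_stabilizer G n \<subseteq> carrier AutT"
    using level_stabilizerD(2)[OF G] by (auto simp: AutT_simps)
  show "level_stabilizer G n \<noteq> {}"
    using subgroup.one_closed[OF G] by (auto simp: level_stabilizer_def AutT_simps)
next
  fix k assume k: "k \<in> level_stabilizer G n"
  have "(inv\<^bsub>AutT\<^esub> k) v = v" if "v \<in> level n" for v
    using AutT_inv_cancel(1)[OF level_stabilizerD(2)[OF G k], of v] level_stabilizerD(3)[OF G k that]
    by simp
  then show "inv\<^bsub>AutT\<^esub> k \<in> level_stabilizer G n"
    using level_stabilizerD(1)[OF G k] subgroup.m_inv_closed[OF G]
    by (simp add: level_stabilizer_def)
next
  fix k l assume "k \<in> level_stabilizer G n" "l \<in> level_stabilizer G n"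
  then show "k \<otimes>\<^bsub>AutT\<^esub> l \<in> level_stabilizer G n"
    using subgroup.m_closed[OF G, of k l] by (simp add: level_stabilizer_def AutT_simps)
qed

lemma tree_automorphism_level:
  "tree_automorphism g \<Longrightarrow> v \<in> level n \<Longrightarrow> g v \<in> level n"
  by (simp add: level_def length_tree_automorphism)

lemma level_stabilizer_conj:
  assumes G: "subgroup G AutT" and g: "g \<in> G" and k: "k \<in> level_stabilizer G n"
  shows "g \<otimes>\<^bsub>AutT\<^esub> k \<otimes>\<^bsub>AutT\<^esub> inv\<^bsub>AutT\<^esub> g \<in> level_stabilizer G n"
proof -
  have ga: "tree_automorphism g"
    using g subgroup.subset[OF G] by (auto simp: AutT_simps)
  have "g \<otimes>\<^bsub>AutT\<^esub> k \<otimes>\<^bsub>AutT\<^esub> inv\<^bsub>AutT\<^esub> g \<in> G"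
    using g level_stabilizerD(1)[OF G k] G
    by (intro subgroup.m_closed[OF G] subgroup.m_inv_closed[OF G])
  moreover have "(g \<otimes>\<^bsub>AutT\<^esub> k \<otimes>\<^bsub>AutT\<^esub> inv\<^bsub>AutT\<^esub> g) v = v" if "v \<in> level n" for v
    using level_stabilizerD(3)[OF G k tree_automorphism_level[OF ga that]]
    by (simp add: AutT_simps AutT_inv_cancel[OF ga])
  ultimately show ?thesis by (simp add: level_stabilizer_def)
qed

lemma psi_mult:
  assumes G: "subgroup G AutT" and u: "u \<in> level n"
    and k: "k \<in> level_stabilizer G n" and l: "l \<in> level_stabilizer G n"
  shows "psi u (k \<otimes>\<^bsub>AutT\<^esub> l) = psi u k \<otimes>\<^bsub>AutT\<^esub> psi u l"
proof -
  have "k \<otimes>\<^bsub>AutT\<^esub> l \<in> level_stabilizer G n"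
    using level_stabilizer_subgroup[OF G] k l by (rule subgroup.m_closed)
  then have "psi u (k \<otimes>\<^bsub>AutT\<^esub> l) = section_at (k \<otimes>\<^bsub>AutT\<^esub> l) u"
    using psi_level_stabilizer[OF G] u by blast
  also have "\<dots> = section_at k u \<otimes>\<^bsub>AutT\<^esub> section_at l (k u)"
    using level_stabilizerD(2)[OF G k] level_stabilizerD(2)[OF G l] by (rule section_at_mult)
  also have "\<dots> = psi u k \<otimes>\<^bsub>AutT\<^esub> psi u l"
    by (simp only: level_stabilizerD(3)[OF G k u] psi_level_stabilizer[OF G k u]
      psi_level_stabilizer[OF G l u])
  finally show ?thesis .
qed

text \<open>
  Requiring the condition at every vertex of the level is what makes it invariant under
  conjugation: \<open>g\<close> replaces the section at \<open>v\<close> by a conjugate of the section at \<open>g(v)\<close>.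
\<close>
lemma normal_level_sections:
  assumes G: "subgroup G AutT" and ss: "self_similar G" and N: "N \<lhd> AutT\<lparr>carrier := G\<rparr>"
  shows "{k \<in> level_stabilizer G n. \<forall>v \<in> level n. section_at k v \<in> N} \<lhd> AutT\<lparr>carrier := G\<rparr>"
    (is "?M \<lhd> _")
proof -
  have Nsub: "subgroup N AutT"
    and Nconj: "\<And>g k. g \<in> G \<Longrightarrow> k \<in> N \<Longrightarrow> g \<otimes>\<^bsub>AutT\<^esub> k \<otimes>\<^bsub>AutT\<^esub> inv\<^bsub>AutT\<^esub> g \<in> N"
    using N unfolding AutT.normal_in_subgroup_iff[OF G] by blast+
  note st = level_stabilizer_subgroup[OF G, of n]
  have "subgroup ?M AutT"
  proof (rule AutT.subgroupI)
    show "?M \<subseteq> carrier AutT" using subgroup.subset[OF st] by blast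
    have "id \<in> ?M"
      using subgroup.one_closed[OF st] subgroup.one_closed[OF Nsub]
      by (simp add: AutT_simps section_at_one)
    then show "?M \<noteq> {}" by blast
  next
    fix k assume k: "k \<in> ?M"
    then have ka: "tree_automorphism k" and kfix: "\<And>v. v \<in> level n \<Longrightarrow> k v = v"
      using level_stabilizerD[OF G, of k n] by auto
    have "section_at (inv\<^bsub>AutT\<^esub> k) v \<in> N" if v: "v \<in> level n" for v
      using section_at_inv[OF ka, of v] kfix[OF v] v k subgroup.m_inv_closed[OF Nsub] by simp
    then show "inv\<^bsub>AutT\<^esub> k \<in> ?M"
      using k subgroup.m_inv_closed[OF st] by simp
  next
    fix k l assume k: "k \<in> ?M" and l: "l \<in> ?M"
    have "section_at (k \<otimes>\<^bsub>AutT\<^esub> l) v \<in> N" if v: "v \<in> level n" for v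
    proof -
      have "section_at (k \<otimes>\<^bsub>AutT\<^esub> l) v = section_at k v \<otimes>\<^bsub>AutT\<^esub> section_at l v"
        using section_at_mult[of k l v] level_stabilizerD[OF G, of k n] level_stabilizerD[OF G, of l n]
          k l v by simp
      then show ?thesis using k l v subgroup.m_closed[OF Nsub] by simp
    qed
    then show "k \<otimes>\<^bsub>AutT\<^esub> l \<in> ?M"
      using k l subgroup.m_closed[OF st] by simp
  qed
  moreover have "?M \<subseteq> G"
    by (auto simp: level_stabilizer_def)
  moreover have "g \<otimes>\<^bsub>AutT\<^esub> k \<otimes>\<^bsub>AutT\<^esub> inv\<^bsub>AutT\<^esub> g \<in> ?M" if g: "g \<in> G" and k: "k \<in> ?M" for g k
  proof -
    have ga: "tree_automorphism g"
      using g subgroup.subset[OF G] by (auto simp: AutT_simps)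
    have kst: "k \<in> level_stabilizer G n" using k by simp
    have "section_at (g \<otimes>\<^bsub>AutT\<^esub> k \<otimes>\<^bsub>AutT\<^esub> inv\<^bsub>AutT\<^esub> g) v \<in> N" if v: "v \<in> level n" for v
    proof -
      have gv: "g v \<in> level n" using ga v by (rule tree_automorphism_level)
      moreover have "section_at g v \<in> G" using ss g by (simp add: self_similar_def)
      ultimately show ?thesis
        using k section_at_conj[OF ga level_stabilizerD(2)[OF G kst], of v]
          level_stabilizerD(3)[OF G kst gv] Nconj by simp
    qed
    then show ?thesis using level_stabilizer_conj[OF G g kst] by simp
  qed
  ultimately show ?thesis
    unfolding AutT.normal_in_subgroup_iff[OF G] by blast
qed

lemma normal_psi_image:
  assumes G: "subgroup G AutT" and u: "u \<in> level n"
    and onto: "psi u ` level_stabilizer G n = G"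
    and K: "K \<lhd> AutT\<lparr>carrier := G\<rparr>" and Kst: "K \<subseteq> level_stabilizer G n"
  shows "psi u ` K \<lhd> AutT\<lparr>carrier := G\<rparr>"
proof -
  note st = level_stabilizer_subgroup[OF G, of n]
  have stG: "level_stabilizer G n \<subseteq> G" by (auto simp: level_stabilizer_def)
  have "K \<lhd> AutT\<lparr>carrier := level_stabilizer G n\<rparr>"
    using K Kst subsetD[OF stG]
    unfolding AutT.normal_in_subgroup_iff[OF G] AutT.normal_in_subgroup_iff[OF st] by simp
  moreover have "group_hom (AutT\<lparr>carrier := level_stabilizer G n\<rparr>) (AutT\<lparr>carrier := G\<rparr>) (psi u)"
    using AutT.subgroup_imp_group[OF st] AutT.subgroup_imp_group[OF G] psi_mult[OF G u]
      equalityD1[OF onto]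
    by (simp add: group_hom_def group_hom_axioms_def hom_def image_subset_iff_funcset)
  moreover have "psi u ` carrier (AutT\<lparr>carrier := level_stabilizer G n\<rparr>) = carrier (AutT\<lparr>carrier := G\<rparr>)"
    using onto by simp
  ultimately show ?thesis
    by (rule normal.surj_hom_normal_subgroup)
qed

section \<open>Projections of normal closures\<close>

theorem lemma2p10:
  fixes G S K :: "('x::finite list \<Rightarrow> 'x list) set"
    and n :: nat and u :: "'x list"
  assumes "subgroup G AutT"
    and "level_transitive G"
    and "super_strongly_fractal G"
    and "S \<subseteq> G"
    and "K = normal_closure (AutT\<lparr>carrier := G\<rparr>) S"
    and "K \<subseteq> level_stabilizer G n"
    and "u \<in> level n"
  shows "psi u ` K = normal_closure (AutT\<lparr>carrier := G\<rparr>) (\<Union>v \<in> level n. psi v ` S)"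
proof -
  note G = assms(1) and Kst = assms(6) and u = assms(7)
  let ?G = "AutT\<lparr>carrier := G\<rparr>" and ?S = "\<Union>v \<in> level n. psi v ` S"
  let ?N = "normal_closure ?G ?S"
  interpret G: group ?G using G by (rule AutT.subgroup_imp_group)
  have ss: "self_similar G" and onto: "psi u ` level_stabilizer G n = G"
    using assms(3) u by (auto simp: super_strongly_fractal_def)
  have K: "K \<lhd> ?G"
    using G.normal_closure_normal assms(4,5) by simp
  have SK: "S \<subseteq> K"
    unfolding assms(5) by (rule normal_closure_superset)
  have psi: "psi v k = section_at k v" if "k \<in> K" "v \<in> level n" for k v
    using psi_level_stabilizer[OF G] Kst that by blast
  have "?S \<subseteq> G"
    using ss assms(4) psi[OF subsetD[OF SK]] by (auto simp: self_similar_def)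
  then have N: "?N \<lhd> ?G"
    by (intro G.normal_closure_normal) simp
  have SN: "section_at s v \<in> ?N" if s: "s \<in> S" and v: "v \<in> level n" for s v
  proof -
    have "psi v s \<in> ?S" using s v by blast
    then show ?thesis
      using normal_closure_superset[of ?S ?G] psi[OF subsetD[OF SK s] v] by auto
  qed

  have "S \<subseteq> {k \<in> level_stabilizer G n. \<forall>v \<in> level n. section_at k v \<in> ?N}"
    using SN SK Kst by blast
  then have "K \<subseteq> {k \<in> level_stabilizer G n. \<forall>v \<in> level n. section_at k v \<in> ?N}"
    unfolding assms(5) by (rule normal_closure_least[OF _ normal_level_sections[OF G ss N]])
  then have "psi u ` K \<subseteq> ?N"
    using u psi by auto
  moreover have "?N \<subseteq> psi u ` K"
  proof (rule normal_closure_least)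
    show image: "psi u ` K \<lhd> ?G"
      using G u onto K Kst by (rule normal_psi_image)
    show "?S \<subseteq> psi u ` K"
    proof clarify
      fix v :: "'x list" and s assume v: "v \<in> level n" and s: "s \<in> S"
      obtain g where g: "g \<in> G" and gu: "g u = v"
        using assms(2) u v unfolding level_transitive_def by blast
      let ?c = "g \<otimes>\<^bsub>AutT\<^esub> s \<otimes>\<^bsub>AutT\<^esub> inv\<^bsub>AutT\<^esub> g" and ?t = "section_at g u"
      have sst: "s \<in> level_stabilizer G n" using s SK Kst by blast
      have ga: "tree_automorphism g"
        using g subgroup.subset[OF G] by (auto simp: AutT_simps)
      have t: "?t \<in> G" using ss g by (simp add: self_similar_def)
      have carrier: "?t \<in> carrier AutT" "section_at s v \<in> carrier AutT"
        using ga level_stabilizerD(2)[OF G sst]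
        by (auto simp: AutT_simps intro: tree_automorphism_section_at)
      have c: "?c \<in> K"
        using K g s SK unfolding AutT.normal_in_subgroup_iff[OF G] by blast
      have "psi u ?c = ?t \<otimes>\<^bsub>AutT\<^esub> section_at s v \<otimes>\<^bsub>AutT\<^esub> inv\<^bsub>AutT\<^esub> ?t"
        using psi[OF c u] section_at_conj[OF ga level_stabilizerD(2)[OF G sst], of u]
          level_stabilizerD(3)[OF G sst v] gu by simp
      then have "section_at s v = inv\<^bsub>AutT\<^esub> ?t \<otimes>\<^bsub>AutT\<^esub> psi u ?c \<otimes>\<^bsub>AutT\<^esub> inv\<^bsub>AutT\<^esub> (inv\<^bsub>AutT\<^esub> ?t)"
        using carrier by (simp add: AutT_simps(1,2) AutT_inv_cancel fun_eq_iff)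
      moreover have "inv\<^bsub>AutT\<^esub> ?t \<in> G"
        using t by (rule subgroup.m_inv_closed[OF G])
      moreover have "h \<otimes>\<^bsub>AutT\<^esub> k \<otimes>\<^bsub>AutT\<^esub> inv\<^bsub>AutT\<^esub> h \<in> psi u ` K" if "h \<in> G" "k \<in> psi u ` K" for h k
        using image that unfolding AutT.normal_in_subgroup_iff[OF G] by blast
      ultimately have "section_at s v \<in> psi u ` K"
        using imageI[OF c, of "psi u"] by presburger
      then show "psi v s \<in> psi u ` K"
        using psi[OF subsetD[OF SK s] v] by simp
    qed
  qed
  ultimately show ?thesis by (rule subset_antisym)
qed

end
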